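(* There exist ideals $I,J$ on a countably infinite set $X$ such that $\mathcal C_I^{(1)}\subseteq\mathcal C_J^{(1)}$ but $\mathcal C_I\not\subseteq\mathcal C_J$.
   Context: An ideal on $X$ means here a family $I$ of subsets of $X$ that is closed under subsets and finite unions, contains all finite subsets of $X$, contains at least one infinite set, and does not contain all subsets of $X$. For an ideal $I$, $\mathcal C_I$ denotes the set of all finitary operations $f:X^n\to X$ ($n\ge1$) such that $f[A^n]\in I$ for all $A\in I$, and $\mathcal C_I^{(1)}$ denotes the set of unary functions $X\to X$ belonging to $\mathcal C_I$. *)

theory Defs
  imports Main "HOL-Library.Countable_Set" "HOL-Library.FuncSet" "HOL-Library.NList"
begin

definition set_ideal :: "'a set \<Rightarrow> 'a set set \<Rightarrow> bool" where
  "set_ideal X I \<longleftrightarrow>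
     I \<subseteq> Pow X \<and>
     (\<forall>A\<in>I. \<forall>B. B \<subseteq> A \<longrightarrow> B \<in> I) \<and>
     (\<forall>A\<in>I. \<forall>B\<in>I. A \<union> B \<in> I) \<and>
     (\<forall>A. A \<subseteq> X \<and> finite A \<longrightarrow> A \<in> I) \<and>
     (\<exists>A\<in>I. infinite A) \<and>
     I \<noteq> Pow X"

text \<open>
  The power \<open>X\<close> to the \<open>n\<close> is \<open>nlists n X\<close>, the lists of length \<open>n\<close> over \<open>X\<close>.
  A finitary operation is a pair \<open>(n, f)\<close> of its arity \<open>n \<ge> 1\<close> and a function \<open>f\<close> that is
  \<open>undefined\<close> outside its domain, so that equality of pairs is equality of operations.
\<close>

definition finitary_ops :: "'a set \<Rightarrow> (nat \<times> ('a list \<Rightarrow> 'a)) set" where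
  "finitary_ops X = {(n, f). n \<ge> 1 \<and> f \<in> nlists n X \<rightarrow>\<^sub>E X}"

definition ideal_clone :: "'a set \<Rightarrow> 'a set set \<Rightarrow> (nat \<times> ('a list \<Rightarrow> 'a)) set" where
  "ideal_clone X I = {(n, f) \<in> finitary_ops X. \<forall>A\<in>I. f ` nlists n A \<in> I}"

text \<open>A function on \<open>X\<close> is identified with the unary operation taking one-element lists.\<close>

definition unary_op :: "'a set \<Rightarrow> ('a \<Rightarrow> 'a) \<Rightarrow> nat \<times> ('a list \<Rightarrow> 'a)" where
  "unary_op X g = (1, \<lambda>xs\<in>nlists 1 X. g (hd xs))"

definition ideal_clone_unary :: "'a set \<Rightarrow> 'a set set \<Rightarrow> ('a \<Rightarrow> 'a) set" where
  "ideal_clone_unary X I = {g \<in> X \<rightarrow>\<^sub>E X. unary_op X g \<in> ideal_clone X I}"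

end

theory Submission
  imports Defs "HOL-Analysis.Summation_Tests" "HOL-Analysis.Infinite_Sum"
begin

text \<open>
  Given an ideal \<open>I\<close> and an infinite set \<open>S\<close>, let \<open>J\<close> consist of the sets covered by finitely many
  images of \<open>S\<close> under unary members of the clone of \<open>I\<close>. Since these unary functions are closed under
  composition, each of them preserves \<open>J\<close> (\<open>ideal_clone_unary_orbit_ideal\<close>), and \<open>J\<close> is an ideal
  as soon as \<open>X \<notin> J\<close> (\<open>set_ideal_orbit_ideal\<close>). Hence it suffices to find \<open>I\<close>, \<open>S\<close> and a binary operation \<open>f\<close> preserving \<open>I\<close> such that \<open>f\<close> maps the square of
  \<open>S\<close> onto \<open>X\<close>, while \<open>X\<close> is not a finite union of unary images of \<open>S\<close>.

  Identify \<open>X\<close> with \<open>\<nat> \<times> \<nat>\<close> by a bijection \<open>e\<close>. Start from an ideal \<open>K\<close> on \<open>\<nat>\<close>, call a subset of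
  \<open>\<nat> \<times> \<nat>\<close> small if both of its projections are in \<open>K\<close>, and let \<open>S = \<nat> \<times> {0}\<close>. The operation
  \<open>f ((a, b), (c, d)) = (a, c)\<close> preserves smallness and maps \<open>S \<times> S\<close> onto everything. Suppose that
  finitely many unary functions \<open>g\<close> preserving smallness have images of \<open>S\<close> that cover \<open>\<nat> \<times> \<nat>\<close>. For
  each \<open>a\<close> the infinite set \<open>{a} \<times> \<nat>\<close> is covered, so for some \<open>g\<close> there are infinitely many \<open>n\<close>
  such that \<open>g (n, 0)\<close> has first coordinate \<open>a\<close>. As \<open>\<nat> \<notin> K\<close>, one and the same \<open>g\<close> serves all \<open>a\<close>
  from a set \<open>T \<notin> K\<close>. If \<open>K\<close> has the property that every sequence of infinite sets is met by a
  single member of \<open>K\<close>, there is a small subset of \<open>S\<close> which \<open>g\<close> maps to a set whose first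
  projection contains \<open>T\<close>, a contradiction (\<open>row_orbit_proper\<close>). An ideal with this property is the ideal of the sets
  whose sum of reciprocals is finite (\<open>reciprocal_ideal_hits\<close>): from the \<open>k\<close>-th infinite set take
  an element above \<open>2 ^ k\<close>.
\<close>

section \<open>Unary functions preserving an ideal\<close>

lemma set_idealD:
  assumes "set_ideal X I"
  shows set_ideal_sub: "I \<subseteq> Pow X"
    and set_ideal_down: "\<And>A B. A \<in> I \<Longrightarrow> B \<subseteq> A \<Longrightarrow> B \<in> I"
    and set_ideal_Un: "\<And>A B. A \<in> I \<Longrightarrow> B \<in> I \<Longrightarrow> A \<union> B \<in> I"
    and set_ideal_finite: "\<And>A. A \<subseteq> X \<Longrightarrow> finite A \<Longrightarrow> A \<in> I"
    and set_ideal_infinite: "\<exists>A\<in>I. infinite A"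
    and set_ideal_proper: "X \<notin> I"
proof -
  have I: "I \<subseteq> Pow X" "\<forall>A\<in>I. \<forall>B. B \<subseteq> A \<longrightarrow> B \<in> I" "I \<noteq> Pow X"
    using assms unfolding set_ideal_def by simp_all
  show "I \<subseteq> Pow X" by (fact I(1))
  show down: "B \<in> I" if "A \<in> I" "B \<subseteq> A" for A B using I(2) that by simp
  show "X \<notin> I" using I(1,3) down by auto
qed (use assms in \<open>simp_all add: set_ideal_def\<close>)

lemma set_ideal_UN:
  assumes "set_ideal X I" "finite G" "\<And>g. g \<in> G \<Longrightarrow> A g \<in> I"
  shows "(\<Union>g\<in>G. A g) \<in> I"
  using assms(2,3)
proof (induction G rule: finite_induct)
  case empty
  show ?case using assms(1) by (simp add: set_ideal_def)
next
  case (insert x G)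
  then have "A x \<in> I" "(\<Union>g\<in>G. A g) \<in> I" by auto
  then show ?case using assms(1) by (simp add: set_ideal_def)
qed

lemma nlists_1: "nlists 1 A = (\<lambda>a. [a]) ` A"
  using nlists_Suc[of 0 A] by auto

lemma finite_nlists: "finite A \<Longrightarrow> finite (nlists n A)"
  by (induction n) (simp_all add: nlists_Suc)

lemma ideal_clone_unary_iff:
  assumes "I \<subseteq> Pow X"
  shows "g \<in> ideal_clone_unary X I \<longleftrightarrow> g \<in> X \<rightarrow>\<^sub>E X \<and> (\<forall>A\<in>I. g ` A \<in> I)"
proof -
  have op: "(\<lambda>xs\<in>nlists 1 X. g (hd xs)) \<in> nlists 1 X \<rightarrow>\<^sub>E X" if "g \<in> X \<rightarrow>\<^sub>E X"
    using that unfolding nlists_1 by (auto simp: PiE_iff)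
  have "(\<lambda>xs\<in>nlists 1 X. g (hd xs)) ` nlists 1 A = g ` A" if "A \<in> I" for A
  proof -
    have "A \<subseteq> X" using assms that by auto
    then show ?thesis
      unfolding nlists_1 image_image by (intro image_cong) auto
  qed
  then show ?thesis
    using op by (auto simp: ideal_clone_unary_def unary_op_def ideal_clone_def finitary_ops_def)
qed

lemma ideal_clone_unary_compose:
  assumes "I \<subseteq> Pow X" "h \<in> ideal_clone_unary X I" "g \<in> ideal_clone_unary X I"
  shows "compose X h g \<in> ideal_clone_unary X I"
proof -
  have g: "g \<in> X \<rightarrow>\<^sub>E X" "\<And>A. A \<in> I \<Longrightarrow> g ` A \<in> I"
    and h: "h \<in> X \<rightarrow>\<^sub>E X" "\<And>A. A \<in> I \<Longrightarrow> h ` A \<in> I"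
    using assms by (auto simp: ideal_clone_unary_iff)
  have "compose X h g ` A = h ` g ` A" if "A \<in> I" for A
  proof -
    have "A \<subseteq> X" using assms that by auto
    then show ?thesis
      unfolding image_image by (intro image_cong) (auto simp: compose_def)
  qed
  then show ?thesis
    using g h assms(1) by (auto simp: ideal_clone_unary_iff compose_def PiE_iff)
qed

text \<open>
  For a set \<open>F\<close> of functions that contains the identity and all composites of its members, this is
  the least \<open>F\<close>-invariant family containing \<open>S\<close> that is closed under subsets and finite unions.
\<close>

definition orbit_ideal :: "('a \<Rightarrow> 'a) set \<Rightarrow> 'a set \<Rightarrow> 'a set set" where
  "orbit_ideal F S = {B. \<exists>G. finite G \<and> G \<subseteq> F \<and> B \<subseteq> (\<Union>g\<in>G. g ` S)}"

lemma orbit_idealI: "g \<in> F \<Longrightarrow> B \<subseteq> g ` S \<Longrightarrow> B \<in> orbit_ideal F S"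
  unfolding orbit_ideal_def by (auto intro!: exI[of _ "{g}"])

lemma orbit_ideal_subset:
  assumes "A \<in> orbit_ideal F S" "B \<subseteq> A"
  shows "B \<in> orbit_ideal F S"
  using assms unfolding orbit_ideal_def by (auto dest: subset_trans[OF assms(2)])

lemma orbit_ideal_Un:
  assumes "A \<in> orbit_ideal F S" "B \<in> orbit_ideal F S"
  shows "A \<union> B \<in> orbit_ideal F S"
proof -
  obtain G H where "finite G" "G \<subseteq> F" "A \<subseteq> (\<Union>g\<in>G. g ` S)" "finite H" "H \<subseteq> F" "B \<subseteq> (\<Union>g\<in>H. g ` S)"
    using assms unfolding orbit_ideal_def by auto
  then show ?thesis
    unfolding orbit_ideal_def by (intro CollectI exI[of _ "G \<union> H"]) auto
qed

lemma id_in_ideal_clone_unary: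
  assumes "I \<subseteq> Pow X"
  shows "restrict id X \<in> ideal_clone_unary X I"
proof -
  have "restrict id X ` A = A" if "A \<in> I" for A
  proof -
    have "restrict id X ` A = id ` A" using assms that by (intro image_cong) auto
    then show ?thesis by simp
  qed
  then show ?thesis
    using assms by (auto simp: ideal_clone_unary_iff)
qed

lemma self_in_orbit_ideal:
  assumes "I \<subseteq> Pow X" "S \<subseteq> X"
  shows "S \<in> orbit_ideal (ideal_clone_unary X I) S"
proof (rule orbit_idealI[OF id_in_ideal_clone_unary[OF assms(1)]])
  have "restrict id X ` S = id ` S" using assms(2) by (intro image_cong) auto
  then show "S \<subseteq> restrict id X ` S" by simp
qed

text \<open>
  Singletons are images of \<open>S\<close> under constant functions, which preserve \<open>I\<close> because it contains
  all finite sets.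
\<close>

lemma set_ideal_orbit_ideal:
  assumes I: "set_ideal X I" and S: "S \<subseteq> X" "infinite S"
    and proper: "X \<notin> orbit_ideal (ideal_clone_unary X I) S"
  shows "set_ideal X (orbit_ideal (ideal_clone_unary X I) S)"
proof -
  let ?F = "ideal_clone_unary X I"
  let ?J = "orbit_ideal ?F S"
  have sub: "I \<subseteq> Pow X" and fin: "\<And>A. A \<subseteq> X \<Longrightarrow> finite A \<Longrightarrow> A \<in> I"
    using I by (auto simp: set_ideal_def)
  have maps: "g ` S \<subseteq> X" if "g \<in> ?F" for g
    using that S(1) sub by (auto simp: ideal_clone_unary_iff PiE_iff)
  have singleton: "{x} \<in> ?J" if "x \<in> X" for x
  proof (rule orbit_idealI)
    show "(\<lambda>_\<in>X. x) \<in> ?F"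
      unfolding ideal_clone_unary_iff[OF sub]
    proof (intro conjI ballI)
      fix A assume "A \<in> I"
      then have "(\<lambda>_\<in>X. x) ` A \<subseteq> {x}" using sub by auto
      then show "(\<lambda>_\<in>X. x) ` A \<in> I" using that by (intro fin) (auto intro: finite_subset)
    qed (use that in auto)
    obtain s where "s \<in> S" using S(2) infinite_imp_nonempty by blast
    then show "{x} \<subseteq> (\<lambda>_\<in>X. x) ` S"
      using S(1) by (auto intro!: image_eqI[of _ _ s])
  qed
  have finite_sets: "A \<in> ?J" if "finite A" "A \<subseteq> X" for A
    using that
  proof (induction A rule: finite_induct)
    case empty
    show ?case by (auto simp: orbit_ideal_def)
  next
    case (insert x A)
    then have "{x} \<union> A \<in> ?J" by (intro orbit_ideal_Un singleton) auto
    then show ?case by simp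
  qed
  show ?thesis
    unfolding set_ideal_def
  proof (intro conjI ballI allI impI)
    show "?J \<subseteq> Pow X"
    proof
      fix B assume "B \<in> ?J"
      then obtain G where "G \<subseteq> ?F" "B \<subseteq> (\<Union>g\<in>G. g ` S)" unfolding orbit_ideal_def by auto
      then show "B \<in> Pow X" using maps by blast
    qed
    show "B \<in> ?J" if "A \<in> ?J" "B \<subseteq> A" for A B
      using that orbit_ideal_subset by metis
    show "\<exists>A\<in>?J. infinite A" using self_in_orbit_ideal[OF sub S(1)] S(2) by blast
    show "?J \<noteq> Pow X" using proper by auto
    show "A \<union> B \<in> ?J" if "A \<in> ?J" "B \<in> ?J" for A B
      using that by (rule orbit_ideal_Un)
    show "A \<in> ?J" if "A \<subseteq> X \<and> finite A" for A
      using that finite_sets by metis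
  qed
qed

lemma ideal_clone_unary_orbit_ideal:
  assumes I: "set_ideal X I" and S: "S \<subseteq> X"
    and J: "set_ideal X (orbit_ideal (ideal_clone_unary X I) S)"
  shows "ideal_clone_unary X I \<subseteq> ideal_clone_unary X (orbit_ideal (ideal_clone_unary X I) S)"
proof
  let ?F = "ideal_clone_unary X I"
  fix h assume h: "h \<in> ?F"
  have subI: "I \<subseteq> Pow X" and subJ: "orbit_ideal ?F S \<subseteq> Pow X"
    using I J by (auto simp: set_ideal_def)
  have "h ` B \<in> orbit_ideal ?F S" if B: "B \<in> orbit_ideal ?F S" for B
  proof -
    obtain G where G: "finite G" "G \<subseteq> ?F" "B \<subseteq> (\<Union>g\<in>G. g ` S)"
      using B unfolding orbit_ideal_def by auto
    have "h ` g ` S = compose X h g ` S" for g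
      using S unfolding image_image by (intro image_cong) (auto simp: compose_def)
    then have "h ` (\<Union>g\<in>G. g ` S) = (\<Union>k\<in>compose X h ` G. k ` S)"
      by (simp add: image_UN)
    then have "h ` B \<subseteq> (\<Union>k\<in>compose X h ` G. k ` S)"
      using image_mono[OF G(3)] by metis
    moreover have "compose X h ` G \<subseteq> ?F"
      using G(2) ideal_clone_unary_compose[OF subI h] by auto
    ultimately show ?thesis
      using G(1) unfolding orbit_ideal_def by (intro CollectI exI[of _ "compose X h ` G"]) auto
  qed
  then show "h \<in> ideal_clone_unary X (orbit_ideal ?F S)"
    using h unfolding ideal_clone_unary_iff[OF subJ] by (simp add: ideal_clone_unary_iff[OF subI])
qed

section \<open>The ideal of sets with finite sum of reciprocals\<close>

text \<open>The number \<open>0\<close> carries weight \<open>0\<close>, because \<open>inverse 0 = 0\<close>.\<close>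

definition reciprocal_ideal :: "nat set set" where
  "reciprocal_ideal = {A. (\<lambda>n. inverse (real n)) summable_on A}"

text \<open>
  Being infinite, the \<open>k\<close>-th set has an element of weight below \<open>(1/2) ^ k\<close>, and the geometric
  series bounds the total weight of these elements. Applied to the sets \<open>{k<..}\<close>, this also shows
  that the ideal has infinite members.
\<close>

lemma reciprocal_ideal_hits:
  assumes "\<And>k. infinite (B k)"
  shows "\<exists>A\<in>reciprocal_ideal. \<forall>k::nat. A \<inter> B k \<noteq> {}"
proof -
  have "\<forall>k. \<exists>n. 2 ^ k < n \<and> n \<in> B k"
  proof
    fix k
    have "\<forall>m. \<exists>n. m < n \<and> n \<in> B k"
      using iffD1[OF infinite_nat_iff_unbounded assms[of k]] .
    then show "\<exists>n. 2 ^ k < n \<and> n \<in> B k" by (rule spec)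
  qed
  from choice[OF this] obtain b where "\<forall>k. 2 ^ k < b k \<and> b k \<in> B k" ..
  then have b: "\<And>k. b k \<in> B k" "\<And>k. 2 ^ k < b k" by simp_all
  \<comment> \<open>The choices need not be distinct; one index is kept for each chosen element.\<close>
  obtain U where U: "inj_on b U" "range b = b ` U"
    using iffD1[OF subset_image_inj subset_refl[of "range b"]] by blast
  have "(\<lambda>k. (1/2::real) ^ k) summable_on UNIV"
    by (subst summable_on_UNIV_nonneg_real_iff) (auto intro: summable_geometric)
  then have geometric: "(\<lambda>k. (1/2::real) ^ k) summable_on U"
    by (rule summable_on_subset_banach) simp
  have "inverse (real (b k)) \<le> (1/2) ^ k" for k
  proof -
    have "2 ^ k \<le> real (b k)"
      using b(2)[of k] by (metis less_imp_le of_nat_le_iff of_nat_numeral of_nat_power)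
    then have "inverse (real (b k)) \<le> inverse (2 ^ k)"
      by (intro le_imp_inverse_le) auto
    then show ?thesis by (simp add: power_one_over inverse_eq_divide)
  qed
  then have "(\<lambda>k. inverse (real (b k))) summable_on U"
    by (intro summable_on_comparison_test[OF geometric]) auto
  then have "range b \<in> reciprocal_ideal"
    unfolding reciprocal_ideal_def U(2) by (simp add: summable_on_reindex[OF U(1)] comp_def)
  moreover have "\<forall>k. range b \<inter> B k \<noteq> {}" using b(1) by auto
  ultimately show ?thesis by (rule bexI[rotated])
qed

lemma set_ideal_reciprocal_ideal: "set_ideal UNIV reciprocal_ideal"
  unfolding set_ideal_def
proof (intro conjI ballI allI impI)
  show "B \<in> reciprocal_ideal" if "A \<in> reciprocal_ideal" "B \<subseteq> A" for A B
    using that summable_on_subset_banach unfolding reciprocal_ideal_def by blast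
  show "A \<union> B \<in> reciprocal_ideal" if "A \<in> reciprocal_ideal" "B \<in> reciprocal_ideal" for A B
    using that summable_on_union unfolding reciprocal_ideal_def by blast
  show "A \<in> reciprocal_ideal" if "A \<subseteq> UNIV \<and> finite A" for A
    using that by (simp add: reciprocal_ideal_def)
  show "\<exists>A\<in>reciprocal_ideal. infinite A"
  proof -
    obtain A where A: "A \<in> reciprocal_ideal" "\<And>k. A \<inter> {k<..} \<noteq> {}"
      using reciprocal_ideal_hits[of "\<lambda>k. {k<..}"] by (auto simp: infinite_Ioi)
    then have "infinite A"
      unfolding infinite_nat_iff_unbounded by blast
    then show ?thesis using A(1) by blast
  qed
  have "UNIV \<notin> reciprocal_ideal"
    unfolding reciprocal_ideal_def
    by (simp add: summable_on_UNIV_nonneg_real_iff not_summable_harmonic)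
  then show "reciprocal_ideal \<noteq> Pow UNIV" by auto
qed auto

section \<open>Sets with small projections\<close>

definition box_ideal :: "'a set \<Rightarrow> ('a \<Rightarrow> nat \<times> nat) \<Rightarrow> nat set set \<Rightarrow> 'a set set" where
  "box_ideal X e K = {A. A \<subseteq> X \<and> (fst \<circ> e) ` A \<in> K \<and> (snd \<circ> e) ` A \<in> K}"

lemma set_ideal_box_ideal:
  assumes e: "bij_betw e X UNIV" and K: "set_ideal UNIV K"
  shows "set_ideal X (box_ideal X e K)"
proof -
  note down = set_ideal_down[OF K]
  have fin: "A \<in> K" if "finite A" for A
    using set_ideal_finite[OF K] that by simp
  obtain A where A: "A \<in> K" "infinite A"
    using set_ideal_infinite[OF K] by blast
  note set_ideal_proper[OF K]
  moreover have "(fst \<circ> e) ` X = UNIV"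
    using e unfolding image_comp[symmetric] bij_betw_def by auto
  ultimately have proper: "X \<notin> box_ideal X e K"
    unfolding box_ideal_def by auto
  define R where "R = {x \<in> X. fst (e x) \<in> A \<and> snd (e x) = 0}"
  have R: "(fst \<circ> e) ` R = A"
  proof
    show "A \<subseteq> (fst \<circ> e) ` R"
    proof
      fix a assume a: "a \<in> A"
      obtain x where "x \<in> X" "e x = (a, 0)"
        using e unfolding bij_betw_def by (metis UNIV_I imageE)
      then show "a \<in> (fst \<circ> e) ` R"
        using a unfolding R_def by (intro image_eqI[of _ _ x]) auto
    qed
  qed (auto simp: R_def)
  have "finite ((snd \<circ> e) ` R)"
    by (rule finite_subset[of _ "{0}"]) (auto simp: R_def)
  then have "R \<in> box_ideal X e K"
    using R A(1) fin unfolding box_ideal_def R_def by auto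
  moreover have "infinite R"
    using R A(2) by (metis finite_imageI)
  ultimately have "\<exists>R\<in>box_ideal X e K. infinite R" by (rule bexI[rotated])
  then show ?thesis
    unfolding set_ideal_def
  proof (intro conjI ballI allI impI)
    show "B \<in> box_ideal X e K" if "A \<in> box_ideal X e K" "B \<subseteq> A" for A B
    proof -
      have "B \<subseteq> X" "(fst \<circ> e) ` B \<in> K" "(snd \<circ> e) ` B \<in> K"
        using that down[OF _ image_mono[OF that(2)]] unfolding box_ideal_def by auto
      then show ?thesis by (simp add: box_ideal_def)
    qed
    show "A \<union> B \<in> box_ideal X e K" if "A \<in> box_ideal X e K" "B \<in> box_ideal X e K" for A B
      using that set_ideal_Un[OF K] by (simp add: box_ideal_def image_Un)
    show "A \<in> box_ideal X e K" if "A \<subseteq> X \<and> finite A" for A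
      using that fin by (simp add: box_ideal_def)
    show "box_ideal X e K \<noteq> Pow X" using proper by auto
  qed (auto simp: box_ideal_def)
qed

text \<open>
  The obstruction comes from the first coordinate alone. A cover of the grid by finitely many images
  of a row makes the first coordinate of some \<open>g\<close> take each value of a set \<open>T \<notin> K\<close> infinitely
  often. One member of \<open>K\<close> then selects a preimage of each of these values, and \<open>g\<close> maps a small
  set to one whose projection is too large.
\<close>

lemma row_orbit_proper:
  assumes e: "bij_betw e X UNIV" and K: "set_ideal UNIV K"
    and hits: "\<And>B :: nat \<Rightarrow> nat set. (\<And>k. infinite (B k)) \<Longrightarrow> \<exists>A\<in>K. \<forall>k. A \<inter> B k \<noteq> {}"
  shows "X \<notin> orbit_ideal (ideal_clone_unary X (box_ideal X e K)) {x \<in> X. snd (e x) = 0}"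
proof
  let ?I = "box_ideal X e K"
  let ?S = "{x \<in> X. snd (e x) = 0}"
  define u where "u = inv_into X e"
  have u: "u z \<in> X" "e (u z) = z" for z
    using e unfolding u_def bij_betw_def
    by (metis UNIV_I inv_into_into, metis UNIV_I f_inv_into_f)
  have ue: "u (e x) = x" if "x \<in> X" for x
    using e that unfolding u_def bij_betw_def by simp
  have sub: "?I \<subseteq> Pow X" by (auto simp: box_ideal_def)
  assume "X \<in> orbit_ideal (ideal_clone_unary X ?I) ?S"
  then obtain G where G: "finite G" "G \<subseteq> ideal_clone_unary X ?I"
    and cover: "X \<subseteq> (\<Union>g\<in>G. g ` ?S)"
    unfolding orbit_ideal_def by blast
  define fib where "fib g a = {n. fst (e (g (u (n, 0)))) = a}" for g a
  \<comment> \<open>The column over \<open>a\<close> is infinite, and it is covered by the points indexed by the sets \<open>fib g a\<close>.\<close>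
  have some_infinite: "\<exists>g\<in>G. infinite (fib g a)" for a
  proof (rule ccontr)
    assume "\<not> ?thesis"
    then have "finite (\<Union>g\<in>G. (\<lambda>n. snd (e (g (u (n, 0))))) ` fib g a)"
      using G(1) by auto
    moreover have "(\<Union>g\<in>G. (\<lambda>n. snd (e (g (u (n, 0))))) ` fib g a) = UNIV"
    proof (rule UNIV_eq_I[symmetric])
      fix m
      obtain g x where g: "g \<in> G" "x \<in> ?S" "u (a, m) = g x"
        using cover u(1)[of "(a, m)"] by blast
      have "u (fst (e x), 0) = x"
        using ue g(2) by (metis (mono_tags, lifting) mem_Collect_eq prod.collapse)
      then have "e (g (u (fst (e x), 0))) = (a, m)"
        using g(3) u(2) by metis
      then have "fst (e x) \<in> fib g a" "m = snd (e (g (u (fst (e x), 0))))"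
        by (simp_all add: fib_def)
      then show "m \<in> (\<Union>g\<in>G. (\<lambda>n. snd (e (g (u (n, 0))))) ` fib g a)"
        by (intro UN_I[OF g(1)] image_eqI)
    qed
    ultimately show False by simp
  qed
  define T where "T g = {a. infinite (fib g a)}" for g
  have "T g \<in> K" if g: "g \<in> G" for g
  proof -
    \<comment> \<open>Values outside \<open>T g\<close> have finite fibres; for them \<open>UNIV\<close> only asks for \<open>A \<noteq> {}\<close>.\<close>
    have "infinite (if a \<in> T g then fib g a else UNIV)" for a
      by (simp add: T_def)
    from hits[OF this]
    obtain A where A: "A \<in> K" "\<forall>a. A \<inter> (if a \<in> T g then fib g a else UNIV) \<noteq> {}" ..
    define R where "R = (\<lambda>n. u (n, 0)) ` A"
    have "(snd \<circ> e) ` R \<subseteq> {0}" "(fst \<circ> e) ` R = A"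
      unfolding R_def image_image by (auto simp: u)
    moreover have "{0} \<in> K" using set_ideal_finite[OF K] by simp
    ultimately have "(snd \<circ> e) ` R \<in> K" "(fst \<circ> e) ` R \<in> K"
      using A(1) set_ideal_down[OF K] by simp_all
    moreover have "R \<subseteq> X" using u(1) unfolding R_def by auto
    ultimately have "R \<in> ?I" by (simp add: box_ideal_def)
    then have "g ` R \<in> ?I"
      using g G(2) ideal_clone_unary_iff[OF sub] by blast
    then have "(fst \<circ> e) ` g ` R \<in> K"
      unfolding box_ideal_def by blast
    moreover have "T g \<subseteq> (fst \<circ> e) ` g ` R"
    proof
      fix a assume "a \<in> T g"
      then have "A \<inter> fib g a \<noteq> {}"
        using spec[OF A(2), of a] by simp
      then obtain n where "n \<in> A" "a = fst (e (g (u (n, 0))))"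
        unfolding fib_def by blast
      then show "a \<in> (fst \<circ> e) ` g ` R"
        unfolding R_def image_image by (intro image_eqI[of _ _ n]) simp_all
    qed
    ultimately show ?thesis by (rule set_ideal_down[OF K])
  qed
  then have "(\<Union>g\<in>G. T g) \<in> K"
    by (rule set_ideal_UN[OF K G(1)])
  moreover have "(\<Union>g\<in>G. T g) = UNIV"
    using some_infinite unfolding T_def by auto
  ultimately show False
    using set_ideal_proper[OF K] by simp
qed

definition pair_fst_op :: "'a set \<Rightarrow> ('a \<Rightarrow> nat \<times> nat) \<Rightarrow> 'a list \<Rightarrow> 'a" where
  "pair_fst_op X e = (\<lambda>xs\<in>nlists 2 X. inv_into X e (fst (e (xs ! 0)), fst (e (xs ! 1))))"

text \<open>Both projections of the image of \<open>A\<close> lie in the first projection of \<open>A\<close>.\<close>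

lemma pair_fst_op_clone:
  assumes e: "bij_betw e X UNIV" and K: "set_ideal UNIV K"
  shows "(2, pair_fst_op X e) \<in> ideal_clone X (box_ideal X e K)"
proof -
  let ?f = "pair_fst_op X e"
  have u: "inv_into X e z \<in> X" "e (inv_into X e z) = z" for z
    using e unfolding bij_betw_def
    by (metis UNIV_I inv_into_into, metis UNIV_I f_inv_into_f)
  have "?f ` nlists 2 A \<in> box_ideal X e K" if "A \<in> box_ideal X e K" for A
  proof -
    have A: "A \<subseteq> X" "(fst \<circ> e) ` A \<in> K"
      using that by (auto simp: box_ideal_def)
    have entries: "xs \<in> nlists 2 X \<and> xs ! 0 \<in> A \<and> xs ! 1 \<in> A" if "xs \<in> nlists 2 A" for xs
      using that nlists_mono[OF A(1)] by (auto intro: nlistsE_nth_in)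
    have "(fst \<circ> e) ` ?f ` nlists 2 A \<subseteq> (fst \<circ> e) ` A"
      "(snd \<circ> e) ` ?f ` nlists 2 A \<subseteq> (fst \<circ> e) ` A" "?f ` nlists 2 A \<subseteq> X"
      using entries by (auto simp: pair_fst_op_def u)
    then show ?thesis
      using set_ideal_down[OF K A(2)] unfolding box_ideal_def by simp
  qed
  moreover have "?f \<in> nlists 2 X \<rightarrow>\<^sub>E X"
    unfolding pair_fst_op_def using u(1) by auto
  ultimately show ?thesis
    by (auto simp: ideal_clone_def finitary_ops_def)
qed

lemma pair_fst_op_row:
  assumes e: "bij_betw e X UNIV"
  shows "X \<subseteq> pair_fst_op X e ` nlists 2 {x \<in> X. snd (e x) = 0}"
proof
  fix x assume x: "x \<in> X"
  have u: "inv_into X e z \<in> X" "e (inv_into X e z) = z" for z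
    using e unfolding bij_betw_def
    by (metis UNIV_I inv_into_into, metis UNIV_I f_inv_into_f)
  let ?xs = "[inv_into X e (fst (e x), 0), inv_into X e (snd (e x), 0)]"
  have row: "?xs \<in> nlists 2 {x \<in> X. snd (e x) = 0}"
    unfolding numeral_2_eq_2 Cons_in_nlists_Suc nlists_n_0 mem_Collect_eq u(2) snd_conv
    by (intro conjI u(1) singletonI refl)
  have "?xs \<in> nlists 2 X"
    unfolding numeral_2_eq_2 Cons_in_nlists_Suc nlists_n_0 by (intro conjI u(1) singletonI)
  then have "pair_fst_op X e ?xs = inv_into X e (e x)"
    unfolding pair_fst_op_def restrict_def
    by (simp only: if_True nth_Cons_0 One_nat_def nth_Cons_Suc u fst_conv prod.collapse)
  also have "\<dots> = x"
    using x e unfolding bij_betw_def by (intro inv_into_f_f) auto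
  finally show "x \<in> pair_fst_op X e ` nlists 2 {x \<in> X. snd (e x) = 0}"
    using row by (intro image_eqI) (rule sym)
qed

theorem mainTheorem10:
  fixes X :: "'a set"
  assumes "countable X" and "infinite X"
  shows "\<exists>I J. set_ideal X I \<and> set_ideal X J \<and>
           ideal_clone_unary X I \<subseteq> ideal_clone_unary X J \<and>
           \<not> ideal_clone X I \<subseteq> ideal_clone X J"
proof -
  obtain e :: "'a \<Rightarrow> nat \<times> nat" where e: "bij_betw e X UNIV"
    using assms by (metis bij_betw_trans bij_prod_decode countableE_infinite)
  let ?K = reciprocal_ideal
  let ?I = "box_ideal X e ?K" and ?S = "{x \<in> X. snd (e x) = 0}"
  let ?J = "orbit_ideal (ideal_clone_unary X ?I) ?S"
  have I: "set_ideal X ?I"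
    using set_ideal_box_ideal[OF e set_ideal_reciprocal_ideal] .
  have S: "?S \<subseteq> X" by auto
  have onto: "X \<subseteq> pair_fst_op X e ` nlists 2 ?S"
    using pair_fst_op_row[OF e] .
  have inf: "infinite ?S"
  proof
    assume "finite ?S"
    then have "finite (pair_fst_op X e ` nlists 2 ?S)"
      by (intro finite_imageI finite_nlists)
    then show False
      using finite_subset[OF onto] assms(2) by simp
  qed
  have proper: "X \<notin> ?J"
    using row_orbit_proper[OF e set_ideal_reciprocal_ideal reciprocal_ideal_hits] .
  have J: "set_ideal X ?J"
    using set_ideal_orbit_ideal[OF I S inf proper] .
  have "(2, pair_fst_op X e) \<notin> ideal_clone X ?J"
  proof
    assume "(2, pair_fst_op X e) \<in> ideal_clone X ?J"
    moreover have "?S \<in> ?J"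
      using self_in_orbit_ideal[OF set_ideal_sub[OF I] S] .
    ultimately have "pair_fst_op X e ` nlists 2 ?S \<in> ?J"
      unfolding ideal_clone_def by simp
    then have "X \<in> ?J"
      using onto by (rule set_ideal_down[OF J])
    with proper show False ..
  qed
  then have "\<not> ideal_clone X ?I \<subseteq> ideal_clone X ?J"
    using pair_fst_op_clone[OF e set_ideal_reciprocal_ideal] by (metis subsetD)
  with I J ideal_clone_unary_orbit_ideal[OF I S J] show ?thesis
    by (intro exI conjI)
qed

end
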